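(* For every integer $n\ge 27$, every integer in the interval $\left[-\binom{\lfloor(n-15)/3\rfloor}{2},\ \binom{\lfloor(n-15)/3\rfloor}{2}\right]$ is an eigenvalue of the transposition graph $\mathrm{Cay}(S_n,T_n)$.
   Context: $S_n$ is the symmetric group on $\{1,\dots,n\}$ and $T_n\subseteq S_n$ is the set of all transpositions. The transposition graph $\mathrm{Cay}(S_n,T_n)$ is the Cayley graph with vertex set $S_n$ in which $f,g\in S_n$ are adjacent iff $fg^{-1}\in T_n$. Its eigenvalues are the eigenvalues of its adjacency matrix. *)

theory Defs
  imports
    "HOL-Algebra.Sym_Groups"
    "Graph_Theory.Pair_Digraph"
    "Jordan_Normal_Form.Char_Poly"
begin

definition cayley_graph :: "('a, 'b) monoid_scheme \<Rightarrow> 'a set \<Rightarrow> 'a pair_pre_digraph" where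
  "cayley_graph G S =
    \<lparr> pverts = carrier G,
      parcs = {(f, g). f \<in> carrier G \<and> g \<in> carrier G \<and> f \<otimes>\<^bsub>G\<^esub> inv\<^bsub>G\<^esub> g \<in> S} \<rparr>"

definition transpositions :: "nat \<Rightarrow> (nat \<Rightarrow> nat) set" where
  "transpositions n =
    {Transposition.transpose i j | i j. i \<in> {1..n} \<and> j \<in> {1..n} \<and> i \<noteq> j}"

definition transposition_graph :: "nat \<Rightarrow> (nat \<Rightarrow> nat) pair_pre_digraph" where
  "transposition_graph n = cayley_graph (sym_group n) (transpositions n)"

text \<open>
  Matrices of type \<open>mat\<close> are indexed by natural numbers, so the adjacency matrix is taken
  with respect to a list \<open>vs\<close> enumerating the vertices without repetition. A different
  enumeration conjugates the matrix by a permutation matrix.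
\<close>

definition vertex_enumeration :: "'a pair_pre_digraph \<Rightarrow> 'a list \<Rightarrow> bool" where
  "vertex_enumeration G vs \<longleftrightarrow> distinct vs \<and> set vs = pverts G"

definition adjacency_matrix :: "'a pair_pre_digraph \<Rightarrow> 'a list \<Rightarrow> real mat" where
  "adjacency_matrix G vs =
    mat (length vs) (length vs) (\<lambda>(i, j). if (vs ! i, vs ! j) \<in> parcs G then 1 else 0)"

lemma ex_vertex_enumeration_transposition_graph:
  "\<exists>vs. vertex_enumeration (transposition_graph n) vs"
proof -
  have "finite (pverts (transposition_graph n))"
    by (simp add: transposition_graph_def cayley_graph_def sym_group_def finite_permutations)
  then show ?thesis
    unfolding vertex_enumeration_def using finite_distinct_list by blast
qed

end

theory Submission
  imports Defs
begin

text \<open>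
  Fill a Young diagram with \<open>1, \<dots>, n\<close>, let \<open>P\<close> and \<open>Q\<close> be its row and column groups, and let \<open>v\<close>
  be the Young symmetrizer: \<open>v (p \<circ> q) = sign q\<close> on \<open>P Q\<close> and \<open>v = 0\<close> elsewhere. A permutation
  \<open>f\<close> outside \<open>P Q\<close> admits transpositions \<open>t \<in> P\<close> and \<open>t' \<in> Q\<close> with \<open>t \<circ> f = f \<circ> t'\<close>, so
  every conjugation invariant sum of left translates of \<open>v\<close> vanishes at \<open>f\<close>. Hence \<open>v\<close> is an
  eigenvector, and its eigenvalue is the number of transpositions in \<open>P\<close> minus the number in
  \<open>Q\<close>, which is the sum of the contents \<open>j - i\<close> of the cells \<open>(i, j)\<close>.

  In Frobenius coordinates this sum splits over the principal hooks. Distributing a fixed number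
  \<open>s\<close> of cells among arm and leg of the outermost hook gives an arithmetic progression of
  difference \<open>s + 1\<close>, and inner partitions realising all contents in \<open>{-s/2..s/2}\<close> fill the gaps.
  An induction starting from explicit partitions of 13 and 17 then produces every required
  integer.
\<close>

section \<open>The Young symmetrizer\<close>

lemma transposition_permutes: "\<tau> \<in> transpositions n \<Longrightarrow> \<tau> permutes {1..n}"
  unfolding transpositions_def by (clarify, rule permutes_swap_id)

lemma transposition_involutory: "\<tau> \<in> transpositions n \<Longrightarrow> \<tau> \<circ> \<tau> = id"
  unfolding transpositions_def by auto

lemma finite_transpositions: "finite (transpositions n)"
proof (rule finite_subset)
  show "transpositions n \<subseteq> {p. p permutes {1..n}}"
    using transposition_permutes by blast
qed (simp add: finite_permutations)

lemma comp_transpose_comp_inv: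
  assumes "bij p"
  shows "p \<circ> Transposition.transpose a b \<circ> inv' p = Transposition.transpose (p a) (p b)"
proof
  fix x
  obtain y where "x = p y" using assms by (metis bij_pointE)
  then show "(p \<circ> Transposition.transpose a b \<circ> inv' p) x = Transposition.transpose (p a) (p b) x"
    using transpose_apply_commute[OF assms, of "p a" "p b" y] assms by (simp add: bij_is_inj)
qed

lemma conj_transposition:
  assumes "p permutes {1..n}" "\<tau> \<in> transpositions n"
  shows "p \<circ> \<tau> \<circ> inv' p \<in> transpositions n"
proof -
  obtain i j where ij: "i \<in> {1..n}" "j \<in> {1..n}" "i \<noteq> j" "\<tau> = Transposition.transpose i j"
    using assms(2) unfolding transpositions_def by blast
  have "p i \<in> {1..n}" "p j \<in> {1..n}" "p i \<noteq> p j"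
    using ij permutes_in_image[OF assms(1)] permutes_inj[OF assms(1)] by (auto simp: inj_eq)
  then show ?thesis
    unfolding ij comp_transpose_comp_inv[OF permutes_bij[OF assms(1)]] transpositions_def by blast
qed

text \<open>Lets a sum over \<open>\<tau>\<close> be reindexed by
  \<open>p \<circ> \<tau> \<circ> inv' p\<close>, which is how conjugation invariance
  enters.\<close>

lemma bij_betw_conj_transpositions:
  assumes "p permutes {1..n}"
  shows "bij_betw (\<lambda>\<tau>. p \<circ> \<tau> \<circ> inv' p) (transpositions n) (transpositions n)"
proof (rule bij_betwI[where g = "\<lambda>\<tau>. inv' p \<circ> \<tau> \<circ> p"])
  show "(\<lambda>\<tau>. p \<circ> \<tau> \<circ> inv' p) \<in> transpositions n \<rightarrow> transpositions n"
    using conj_transposition[OF assms] by blast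
  show "(\<lambda>\<tau>. inv' p \<circ> \<tau> \<circ> p) \<in> transpositions n \<rightarrow> transpositions n"
    using conj_transposition[OF permutes_inv[OF assms]] permutes_inv_inv[OF assms] by auto
qed (use permutes_inverses[OF assms] in \<open>auto simp: fun_eq_iff\<close>)

text \<open>The neighbours of \<open>f\<close> are the products \<open>\<tau> \<circ> f\<close>.\<close>

lemma eigenvalue_transposition_graphI:
  fixes v :: "(nat \<Rightarrow> nat) \<Rightarrow> real"
  assumes vs: "vertex_enumeration (transposition_graph n) vs"
    and g: "g permutes {1..n}" "v g \<noteq> 0"
    and eig: "\<And>f. f permutes {1..n} \<Longrightarrow> (\<Sum>\<tau>\<in>transpositions n. v (\<tau> \<circ> f)) = c * v f"
  shows "eigenvalue (adjacency_matrix (transposition_graph n) vs) c"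
proof -
  define N where "N = length vs"
  define w where "w = vec N (\<lambda>i. v (vs ! i))"
  let ?M = "adjacency_matrix (transposition_graph n) vs"
  have dist: "distinct vs" and set: "set vs = {p. p permutes {1..n}}"
    using vs by (auto simp: vertex_enumeration_def transposition_graph_def cayley_graph_def
      sym_group_def)
  have arc: "(f, h) \<in> parcs (transposition_graph n) \<longleftrightarrow> f \<circ> inv' h \<in> transpositions n"
    if "f permutes {1..n}" "h permutes {1..n}" for f h
    using that by (auto simp: transposition_graph_def cayley_graph_def sym_group_carrier sym_group_mult)
  have dims: "dim_row ?M = N" "dim_col ?M = N" by (auto simp: adjacency_matrix_def N_def)
  have "?M *\<^sub>v w = c \<cdot>\<^sub>v w"
  proof (rule eq_vecI)
    fix i assume "i < dim_vec (c \<cdot>\<^sub>v w)"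
    then have i: "i < N" by (simp add: w_def)
    define f where "f = vs ! i"
    have f: "f permutes {1..n}" using i set nth_mem[of i vs] by (simp add: f_def N_def)
    let ?a = "\<lambda>h. if f \<circ> inv' h \<in> transpositions n then v h else 0"
    have "(?M *\<^sub>v w) $ i = (\<Sum>j = 0..<N. ?a (vs ! j))"
    proof -
      have "(?M *\<^sub>v w) $ i = (\<Sum>j = 0..<N. ?M $$ (i, j) * v (vs ! j))"
        using i dims by (simp add: scalar_prod_def w_def)
      also have "\<dots> = (\<Sum>j = 0..<N. ?a (vs ! j))"
      proof (rule sum.cong)
        fix j assume "j \<in> {0..<N}"
        then have "j < N" "vs ! j permutes {1..n}" using set nth_mem[of j vs] by (auto simp: N_def)
        then show "?M $$ (i, j) * v (vs ! j) = ?a (vs ! j)"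
          using i arc[OF f, of "vs ! j"] by (simp add: adjacency_matrix_def N_def f_def)
      qed simp
      finally show ?thesis .
    qed
    also have "\<dots> = sum_list (map ?a vs)"
      by (simp add: sum_list_sum_nth N_def)
    also have "\<dots> = sum ?a {h. h permutes {1..n}}"
      using dist set by (simp add: sum_list_distinct_conv_sum_set)
    also have "\<dots> = sum v {h. h permutes {1..n} \<and> f \<circ> inv' h \<in> transpositions n}"
      by (subst sum.inter_filter[symmetric]) (auto simp: finite_permutations)
    also have "\<dots> = (\<Sum>\<tau>\<in>transpositions n. v (\<tau> \<circ> f))"
    proof (rule sum.reindex_bij_witness[where i = "\<lambda>\<tau>. \<tau> \<circ> f" and j = "\<lambda>h. f \<circ> inv' h"])
      fix h assume h: "h \<in> {h. h permutes {1..n} \<and> f \<circ> inv' h \<in> transpositions n}"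
      \<comment> \<open>A transposition is its own inverse, so \<open>f \<circ> inv' h\<close>
        equals \<open>h \<circ> inv' f\<close>; composing with \<open>f\<close> returns
        \<open>h\<close>.\<close>
      then have "inv' (f \<circ> inv' h) = f \<circ> inv' h"
        using transposition_involutory inv_unique_comp by blast
      then have "f \<circ> inv' h = h \<circ> inv' f"
        using h permutes_inv_inv[of h "{1..n}"] permutes_bij[OF f]
          permutes_bij[OF permutes_inv[of h "{1..n}"]] by (simp add: o_inv_distrib)
      then show "f \<circ> inv' h \<circ> f = h"
        using permutes_inverses[OF f] by (auto simp: fun_eq_iff)
      then show "v (f \<circ> inv' h \<circ> f) = v h" by simp
    next
      fix \<tau> assume \<tau>: "\<tau> \<in> transpositions n"
      have "inv' (\<tau> \<circ> f) = inv' f \<circ> \<tau>"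
        using transposition_permutes[OF \<tau>] transposition_involutory[OF \<tau>] f
        by (simp add: o_inv_distrib permutes_bij inv_unique_comp)
      then show *: "f \<circ> inv' (\<tau> \<circ> f) = \<tau>"
        using permutes_inverses[OF f] by (auto simp: fun_eq_iff)
      show "\<tau> \<circ> f \<in> {h. h permutes {1..n} \<and> f \<circ> inv' h \<in> transpositions n}"
        using \<tau> * permutes_compose[OF f transposition_permutes[OF \<tau>]] by simp
    qed auto
    also have "\<dots> = c * v f" by (rule eig[OF f])
    finally show "(?M *\<^sub>v w) $ i = (c \<cdot>\<^sub>v w) $ i" using i by (simp add: w_def f_def)
  qed (simp add: w_def dims)
  moreover have "w \<noteq> 0\<^sub>v N"
  proof -
    obtain i where "i < N" "vs ! i = g"
      using set g(1) by (metis N_def in_set_conv_nth mem_Collect_eq)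
    then have "w $ i \<noteq> 0\<^sub>v N $ i" using g(2) by (simp add: w_def)
    then show ?thesis by metis
  qed
  ultimately show ?thesis
    unfolding eigenvalue_def eigenvector_def dims by (intro exI[of _ w]) (auto simp: w_def)
qed

text \<open>Entry \<open>x\<close> sits in the cell \<open>(row x, col x)\<close>. Coordinates start
  at 0, so \<open>col x - row x\<close> is the content and \<open>col x\<close> counts the cells to
  its left.\<close>

locale young_filling =
  fixes n :: nat and row col :: "nat \<Rightarrow> nat"
  assumes cell_unique: "\<lbrakk>x \<in> {1..n}; y \<in> {1..n}; row x = row y; col x = col y\<rbrakk> \<Longrightarrow> x = y"
    and down_closed: "\<lbrakk>x \<in> {1..n}; i \<le> row x; j \<le> col x\<rbrakk> \<Longrightarrow> \<exists>y\<in>{1..n}. row y = i \<and> col y = j"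
begin

section \<open>Row group, column group and the coefficients of the symmetrizer\<close>

definition row_group :: "(nat \<Rightarrow> nat) set" where
  "row_group = {p. p permutes {1..n} \<and> (\<forall>x. row (p x) = row x)}"

definition col_group :: "(nat \<Rightarrow> nat) set" where
  "col_group = {q. q permutes {1..n} \<and> (\<forall>x. col (q x) = col x)}"

definition factors :: "(nat \<Rightarrow> nat) \<Rightarrow> (nat \<Rightarrow> nat) \<Rightarrow> (nat \<Rightarrow> nat) \<Rightarrow> bool" where
  "factors f p q \<longleftrightarrow> p \<in> row_group \<and> q \<in> col_group \<and> f = p \<circ> q"

text \<open>\<open>THE\<close> is well defined: by \<open>factors_unique\<close> the column factor
  is determined by \<open>f\<close>.\<close>

definition young_coeff :: "(nat \<Rightarrow> nat) \<Rightarrow> real" where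
  "young_coeff f =
    (if \<exists>p q. factors f p q then real_of_int (sign (THE q. \<exists>p. factors f p q)) else 0)"

lemma row_group_id: "id \<in> row_group" and col_group_id: "id \<in> col_group"
  by (auto simp: row_group_def col_group_def permutes_id)

lemma row_group_comp: "p \<in> row_group \<Longrightarrow> p' \<in> row_group \<Longrightarrow> p \<circ> p' \<in> row_group"
  and col_group_comp: "q \<in> col_group \<Longrightarrow> q' \<in> col_group \<Longrightarrow> q \<circ> q' \<in> col_group"
  by (auto simp: row_group_def col_group_def permutes_compose)

lemma row_group_permutes: "p \<in> row_group \<Longrightarrow> p permutes {1..n}"
  and col_group_permutes: "q \<in> col_group \<Longrightarrow> q permutes {1..n}"
  by (auto simp: row_group_def col_group_def)

lemma row_group_inv: "p \<in> row_group \<Longrightarrow> inv' p \<in> row_group"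
proof -
  assume p: "p \<in> row_group"
  have "row (inv' p x) = row x" for x
    using p permutes_inverses(1)[OF row_group_permutes[OF p], of x]
    by (metis (mono_tags, lifting) row_group_def mem_Collect_eq)
  then show ?thesis
    using permutes_inv[OF row_group_permutes[OF p]] by (simp add: row_group_def)
qed

lemma col_group_inv: "q \<in> col_group \<Longrightarrow> inv' q \<in> col_group"
proof -
  assume q: "q \<in> col_group"
  have "col (inv' q x) = col x" for x
    using q permutes_inverses(1)[OF col_group_permutes[OF q], of x]
    by (metis (mono_tags, lifting) col_group_def mem_Collect_eq)
  then show ?thesis
    using permutes_inv[OF col_group_permutes[OF q]] by (simp add: col_group_def)
qed

lemma row_col_group_trivial:
  assumes "p \<in> row_group" "p \<in> col_group"
  shows "p = id"
proof
  fix x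
  show "p x = id x"
  proof (cases "x \<in> {1..n}")
    case True
    then show ?thesis
      using assms cell_unique[of "p x" x] permutes_in_image[of p "{1..n}" x]
      by (auto simp: row_group_def col_group_def)
  next
    case False
    then show ?thesis
      using permutes_not_in[OF row_group_permutes[OF assms(1)]] by simp
  qed
qed

text \<open>\<open>inv' p' \<circ> p\<close> equals \<open>q' \<circ> inv' q\<close>, so it lies in
  both groups and fixes every entry.\<close>

lemma factors_unique:
  assumes "factors f p q" "factors f p' q'"
  shows "q = q'"
proof -
  have m: "p \<in> row_group" "p' \<in> row_group" "q \<in> col_group" "q' \<in> col_group" "p \<circ> q = p' \<circ> q'"
    using assms by (auto simp: factors_def)
  note inv = permutes_inverses[OF row_group_permutes[OF m(2)]]
    permutes_inverses[OF col_group_permutes[OF m(3)]]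
  have "inv' p' (p (q x)) = q' x" for x
    using fun_cong[OF m(5), of x] inv by simp
  then have "inv' p' (p x) = q' (inv' q x)" for x
    using inv by metis
  then have "inv' p' \<circ> p = q' \<circ> inv' q" by auto
  moreover have "inv' p' \<circ> p \<in> row_group" "q' \<circ> inv' q \<in> col_group"
    using m row_group_comp row_group_inv col_group_comp col_group_inv by auto
  ultimately have "q' \<circ> inv' q = id" using row_col_group_trivial by simp
  then have "q' (inv' q (q x)) = q x" for x by (metis comp_apply id_apply)
  then show "q = q'" using inv by auto
qed

lemma young_coeff_factors: "factors f p q \<Longrightarrow> young_coeff f = real_of_int (sign q)"
  unfolding young_coeff_def using factors_unique by (auto intro!: arg_cong[of _ _ sign])

text \<open>Only the row factor changes, and multiplying back by \<open>inv' p\<close> shows that no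
  factorization appears where there was none.\<close>

lemma young_coeff_row:
  assumes "p \<in> row_group"
  shows "young_coeff (p \<circ> f) = young_coeff f"
proof (cases "\<exists>p' q. factors f p' q")
  case True
  then obtain p' q where f: "factors f p' q" by blast
  then have "factors (p \<circ> f) (p \<circ> p') q"
    using assms row_group_comp by (auto simp: factors_def comp_assoc)
  then show ?thesis using f young_coeff_factors by metis
next
  case False
  have "\<not> factors (p \<circ> f) p' q" for p' q
  proof
    assume "factors (p \<circ> f) p' q"
    moreover from this have "f = inv' p \<circ> p' \<circ> q"
      using permutes_inv_o(2)[OF row_group_permutes[OF assms]]
      by (metis comp_assoc factors_def id_comp)
    ultimately have "factors f (inv' p \<circ> p') q"
      using assms row_group_comp row_group_inv by (auto simp: factors_def)
    then show False using False by blast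
  qed
  then show ?thesis using False by (simp add: young_coeff_def)
qed

lemma young_coeff_col:
  assumes "q \<in> col_group"
  shows "young_coeff (f \<circ> q) = real_of_int (sign q) * young_coeff f"
proof (cases "\<exists>p q'. factors f p q'")
  case True
  then obtain p q' where f: "factors f p q'" by blast
  then have "factors (f \<circ> q) p (q' \<circ> q)"
    using assms col_group_comp by (auto simp: factors_def comp_assoc)
  then have "young_coeff (f \<circ> q) = real_of_int (sign (q' \<circ> q))"
    using young_coeff_factors by blast
  also have "sign (q' \<circ> q) = sign q' * sign q"
    using f assms by (intro sign_compose)
      (auto simp: factors_def intro!: permutes_imp_permutation[of "{1..n}"] col_group_permutes)
  finally show ?thesis using young_coeff_factors[OF f] by (simp only: of_int_mult mult.commute)
next
  case False
  have "\<not> factors (f \<circ> q) p q'" for p q'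
  proof
    assume "factors (f \<circ> q) p q'"
    moreover from this have "f = p \<circ> (q' \<circ> inv' q)"
      using permutes_inv_o(1)[OF col_group_permutes[OF assms]]
      by (metis comp_assoc factors_def comp_id)
    ultimately have "factors f p (q' \<circ> inv' q)"
      using assms col_group_comp col_group_inv by (auto simp: factors_def)
    then show False using False by blast
  qed
  then show ?thesis using False by (simp add: young_coeff_def)
qed

section \<open>Permutations that are products of a row and a column permutation\<close>

lemma transpose_row_group:
  "a \<in> {1..n} \<Longrightarrow> b \<in> {1..n} \<Longrightarrow> row a = row b \<Longrightarrow> Transposition.transpose a b \<in> row_group"
  by (auto simp: row_group_def permutes_swap_id Transposition.transpose_def)

lemma transpose_col_group:
  "a \<in> {1..n} \<Longrightarrow> b \<in> {1..n} \<Longrightarrow> col a = col b \<Longrightarrow> Transposition.transpose a b \<in> col_group"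
  by (auto simp: col_group_def permutes_swap_id Transposition.transpose_def)

lemma young_coeff_eq_0: "\<nexists>p q. factors f p q \<Longrightarrow> young_coeff f = 0"
  by (simp add: young_coeff_def)

text \<open>The cells \<open>(row (f a), col a)\<close> form a \<open>0/1\<close>-matrix with the same row and column sums as the
  diagram. Comparing, for each \<open>r\<close>, the number of cells in the first \<open>r\<close> rows column by column
  shows that this matrix is the diagram itself.\<close>

lemma factors_exist:
  assumes f: "f permutes {1..n}"
    and no: "\<And>a b. \<lbrakk>a \<in> {1..n}; b \<in> {1..n}; a \<noteq> b; col a = col b\<rbrakk> \<Longrightarrow> row (f a) \<noteq> row (f b)"
  shows "\<exists>p q. factors f p q"
proof -
  define C where "C j = {a\<in>{1..n}. col a = j}" for j
  define h where "h j = card (C j)" for j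
  have finC: "finite (C j)" for j by (simp add: C_def)
  have inj_row: "inj_on row (C j)" for j
    using cell_unique by (auto simp: inj_on_def C_def)
  have inj_rowf: "inj_on (\<lambda>a. row (f a)) (C j)" for j
    unfolding inj_on_def C_def using no by blast
  \<comment> \<open>Columns start in row 0 and have no gaps.\<close>
  have rowC: "row ` C j = {..<h j}" for j
  proof -
    have "row ` C j \<subseteq> {..<h j}"
    proof
      fix i assume "i \<in> row ` C j"
      then obtain a where a: "a \<in> C j" "i = row a" by blast
      have "{..i} \<subseteq> row ` C j"
      proof
        fix i' assume "i' \<in> {..i}"
        then show "i' \<in> row ` C j"
          using down_closed[of a i' j] a by (force simp: C_def)
      qed
      then have "card {..i} \<le> card (row ` C j)" using finC by (intro card_mono) auto
      then show "i \<in> {..<h j}" using card_image[OF inj_row] by (simp add: h_def)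
    qed
    then show ?thesis
      using card_image[OF inj_row, of j] by (intro card_subset_eq) (auto simp: h_def)
  qed
  have eq_row: "card {a\<in>C j. row a < r} = min (h j) r" for j r
  proof -
    have "card {a\<in>C j. row a < r} = card (row ` {a\<in>C j. row a < r})"
      by (rule card_image[symmetric], rule inj_on_subset[OF inj_row]) auto
    also have "row ` {a\<in>C j. row a < r} = row ` C j \<inter> {..<r}" by auto
    also have "\<dots> = {..<min (h j) r}" using rowC by auto
    finally show ?thesis by simp
  qed
  \<comment> \<open>The values \<open>row (f a)\<close> are distinct on a column, so at most
    \<open>r\<close> of them lie below \<open>r\<close>, and the column has only \<open>h j\<close>
    cells.\<close>
  have le: "card {a\<in>C j. row (f a) < r} \<le> card {a\<in>C j. row a < r}" for j r
  proof -
    have "card {a\<in>C j. row (f a) < r} \<le> h j"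
      unfolding h_def by (rule card_mono) (auto simp: finC)
    moreover have "card {a\<in>C j. row (f a) < r} \<le> card {..<r}"
      by (rule card_inj_on_le[of "\<lambda>a. row (f a)"], rule inj_on_subset[OF inj_rowf]) auto
    ultimately show ?thesis by (simp add: eq_row)
  qed
  have total: "(\<Sum>j\<in>col ` {1..n}. card {a\<in>C j. P a}) = card {a\<in>{1..n}. P a}" for P
  proof -
    have "{a\<in>{1..n}. P a} = (\<Union>j\<in>col ` {1..n}. {a\<in>C j. P a})" by (auto simp: C_def)
    then show ?thesis
      using finC by (subst card_UN_disjoint[symmetric]) (auto simp: C_def)
  qed
  \<comment> \<open>Since \<open>f\<close> permutes the entries, both counts have the same total
    over all columns, which turns the inequalities \<open>le\<close> into equalities.\<close>
  have "f ` {a\<in>{1..n}. row (f a) < r} = {a\<in>{1..n}. row a < r}" for r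
  proof
    show "f ` {a\<in>{1..n}. row (f a) < r} \<subseteq> {a\<in>{1..n}. row a < r}"
      using permutes_in_image[OF f] by auto
    show "{a\<in>{1..n}. row a < r} \<subseteq> f ` {a\<in>{1..n}. row (f a) < r}"
    proof
      fix b assume b: "b \<in> {a\<in>{1..n}. row a < r}"
      then obtain a where "a \<in> {1..n}" "b = f a" using permutes_image[OF f] by blast
      then show "b \<in> f ` {a\<in>{1..n}. row (f a) < r}" using b by blast
    qed
  qed
  then have "card {a\<in>{1..n}. row (f a) < r} = card {a\<in>{1..n}. row a < r}" for r
    using card_image[OF inj_on_subset[OF permutes_inj[OF f] subset_UNIV]] by metis
  then have sums: "(\<Sum>j\<in>col ` {1..n}. card {a\<in>C j. row (f a) < r})
      = (\<Sum>j\<in>col ` {1..n}. card {a\<in>C j. row a < r})" for r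
    by (simp only: total)
  have bound: "row (f a) < h (col a)" if a: "a \<in> {1..n}" for a
  proof -
    let ?j = "col a"
    \<comment> \<open>With \<open>r = h ?j\<close> the equality counts the whole column.\<close>
    have "card {a\<in>C ?j. row (f a) < h ?j} = card {a\<in>C ?j. row a < h ?j}"
      using sum_mono_inv[OF sums le] a by blast
    then have "card {a\<in>C ?j. row (f a) < h ?j} = card (C ?j)"
      by (simp add: eq_row) (simp add: h_def)
    then have "{a\<in>C ?j. row (f a) < h ?j} = C ?j"
      using finC by (intro card_subset_eq) auto
    then show ?thesis using a by (auto simp: C_def)
  qed
  \<comment> \<open>This \<open>b\<close> is the image of \<open>a\<close> under the column factor:
    it already has the row of \<open>f a\<close>, so the remaining factor preserves rows.\<close>
  have "\<exists>b\<in>{1..n}. col b = col a \<and> row b = row (f a)" if a: "a \<in> {1..n}" for a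
  proof -
    have "row (f a) \<in> row ` C (col a)" unfolding rowC using bound[OF a] by simp
    then show ?thesis by (auto simp: C_def)
  qed
  then obtain q0
    where q0: "\<And>a. a \<in> {1..n} \<Longrightarrow> q0 a \<in> {1..n} \<and> col (q0 a) = col a \<and> row (q0 a) = row (f a)"
    by metis
  define q where "q a = (if a \<in> {1..n} then q0 a else a)" for a
  have qin: "q a \<in> {1..n}" "col (q a) = col a" "row (q a) = row (f a)" if "a \<in> {1..n}" for a
    using q0[OF that] that by (auto simp: q_def)
  have "inj_on q {1..n}"
  proof (rule inj_onI)
    fix a b assume ab: "a \<in> {1..n}" "b \<in> {1..n}" "q a = q b"
    then show "a = b" using no[of a b] qin by metis
  qed
  moreover have "q ` {1..n} \<subseteq> {1..n}" using qin(1) by blast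
  ultimately have "bij_betw q {1..n} {1..n}"
    by (simp add: bij_betw_def endo_inj_surj)
  then have qp: "q permutes {1..n}"
    by (rule bij_imp_permutes) (unfold q_def, rule if_not_P)
  then have q: "q \<in> col_group"
    using qin(2) by (auto simp: col_group_def q_def)
  have "row (f (inv' q y)) = row y" for y
  proof (cases "y \<in> {1..n}")
    case True
    then have "inv' q y \<in> {1..n}" using permutes_in_image[OF permutes_inv[OF qp]] by blast
    then show ?thesis using qin(3)[of "inv' q y"] permutes_inverses(1)[OF qp] by simp
  next
    case False
    then show ?thesis
      using permutes_not_in[OF permutes_inv[OF qp]] permutes_not_in[OF f] by simp
  qed
  then have "f \<circ> inv' q \<in> row_group"
    using permutes_compose[OF permutes_inv[OF qp] f] by (simp add: row_group_def)
  moreover have "f = f \<circ> inv' q \<circ> q"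
    using permutes_inverses(2)[OF qp] by (simp add: fun_eq_iff)
  ultimately show ?thesis using q unfolding factors_def by blast
qed

text \<open>Where \<open>\<tau>\<close> fixes \<open>x\<close>, the entries \<open>q x\<close> and
  \<open>x\<close> share row and column, so \<open>q\<close> fixes \<open>x\<close> too. Thus
  \<open>q\<close> can only swap the two moved entries, which requires equal columns; otherwise
  \<open>q = id\<close> and \<open>\<tau> = p\<close>.\<close>

lemma transposition_factors:
  assumes \<tau>: "\<tau> \<in> transpositions n" and pq: "factors \<tau> p q"
  shows "\<tau> \<in> row_group \<or> \<tau> \<in> col_group"
proof -
  obtain a b where ab: "a \<in> {1..n}" "b \<in> {1..n}" "a \<noteq> b" "\<tau> = Transposition.transpose a b"
    using \<tau> unfolding transpositions_def by blast
  have p: "p \<in> row_group" and q: "q \<in> col_group" and eq: "\<tau> = p \<circ> q"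
    using pq by (auto simp: factors_def)
  have qp: "q permutes {1..n}" using col_group_permutes[OF q] .
  have col: "col (q x) = col x" for x using q by (simp add: col_group_def)
  have fix_other: "q x = x" if x: "x \<noteq> a" "x \<noteq> b" for x
  proof (cases "x \<in> {1..n}")
    case True
    have "p (q x) = x" using fun_cong[OF eq, of x] ab x by simp
    moreover have "row (p (q x)) = row (q x)" using p by (simp add: row_group_def)
    moreover have "q x \<in> {1..n}" using True permutes_in_image[OF qp] by blast
    ultimately show ?thesis using cell_unique[of "q x" x] col True by simp
  qed (use permutes_not_in[OF qp] in simp)
  show ?thesis
  proof (cases "col a = col b")
    case True
    then show ?thesis using transpose_col_group ab by blast
  next
    case False
    have in_ab: "q x \<in> {a, b}" if "x \<in> {a, b}" for x
      using fix_other[of "q x"] permutes_inj[OF qp] that by (auto simp: inj_eq)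
    have "q x = x" for x
    proof (cases "x \<in> {a, b}")
      case True
      then show ?thesis using in_ab[OF True] col[of x] False by auto
    qed (use fix_other in auto)
    then have "q = id" by auto
    then show ?thesis using eq p by simp
  qed
qed

section \<open>Counting transpositions in the row and column groups\<close>

lemma card_row_transpositions: "card (transpositions n \<inter> row_group) = (\<Sum>x=1..n. col x)"
proof -
  \<comment> \<open>Each transposition within a row is charged to its right-hand entry
    \<open>b\<close>, whose partners are the \<open>col b\<close> entries to its left.\<close>
  define S where "S b = {a\<in>{1..n}. row a = row b \<and> col a < col b}" for b
  have cardS: "card (S b) = col b" if b: "b \<in> {1..n}" for b
  proof -
    have "bij_betw col (S b) {..<col b}"
    proof (rule bij_betw_imageI)
      show "inj_on col (S b)" using cell_unique by (auto simp: inj_on_def S_def)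
      show "col ` S b = {..<col b}"
      proof
        show "{..<col b} \<subseteq> col ` S b"
        proof
          fix j assume j: "j \<in> {..<col b}"
          then obtain a where "a \<in> {1..n}" "row a = row b" "col a = j"
            using down_closed[OF b, of "row b" j] by auto
          then show "j \<in> col ` S b" using j by (auto simp: S_def)
        qed
      qed (auto simp: S_def)
    qed
    then show ?thesis using bij_betw_same_card by fastforce
  qed
  have "bij_betw (\<lambda>(b, a). Transposition.transpose a b) (SIGMA b:{1..n}. S b)
      (transpositions n \<inter> row_group)"
  proof (rule bij_betw_imageI)
    show "inj_on (\<lambda>(b, a). Transposition.transpose a b) (SIGMA b:{1..n}. S b)"
    proof (rule inj_onI, clarify)
      fix a b a' b'
      assume *: "a \<in> S b" "a' \<in> S b'" "Transposition.transpose a b = Transposition.transpose a' b'"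
      have "Transposition.transpose a b a = b" "Transposition.transpose a b b = a" by simp_all
      with * show "b = b' \<and> a = a'"
        by (auto simp: S_def transpose_eq_iff)
    qed
    show "(\<lambda>(b, a). Transposition.transpose a b) ` (SIGMA b:{1..n}. S b)
        = transpositions n \<inter> row_group"
    proof (intro equalityI subsetI)
      fix \<tau> assume "\<tau> \<in> (\<lambda>(b, a). Transposition.transpose a b) ` (SIGMA b:{1..n}. S b)"
      then obtain a b where ab: "b \<in> {1..n}" "a \<in> S b" "\<tau> = Transposition.transpose a b" by auto
      then have "a \<in> {1..n}" "row a = row b" "a \<noteq> b" by (auto simp: S_def)
      then show "\<tau> \<in> transpositions n \<inter> row_group"
        using ab transpose_row_group unfolding transpositions_def by blast
    next
      fix \<tau> assume \<tau>: "\<tau> \<in> transpositions n \<inter> row_group"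
      then obtain a b where ab: "a \<in> {1..n}" "b \<in> {1..n}" "a \<noteq> b"
          "\<tau> = Transposition.transpose a b"
        unfolding transpositions_def by blast
      have "row (\<tau> a) = row a" using \<tau> by (simp add: row_group_def)
      then have row: "row b = row a" using ab by simp
      then have "col a \<noteq> col b" using ab cell_unique by metis
      then have "a \<in> S b \<or> b \<in> S a" using ab row by (auto simp: S_def)
      moreover have "\<tau> = Transposition.transpose b a"
        using ab by (simp add: transpose_commute)
      ultimately have "\<exists>b\<in>{1..n}. \<exists>a\<in>S b. \<tau> = Transposition.transpose a b"
        using ab by blast
      then show "\<tau> \<in> (\<lambda>(b, a). Transposition.transpose a b) ` (SIGMA b:{1..n}. S b)"
        by force
    qed
  qed
  then have "card (transpositions n \<inter> row_group) = card (SIGMA b:{1..n}. S b)"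
    by (metis bij_betw_same_card)
  also have "\<dots> = (\<Sum>b=1..n. card (S b))"
    by (rule card_SigmaI) (auto simp: S_def)
  also have "\<dots> = (\<Sum>x=1..n. col x)" using cardS by (intro sum.cong) auto
  finally show ?thesis .
qed

text \<open>Transposing the diagram reduces the column count to the row count.\<close>

lemma young_filling_conjugate: "young_filling n col row"
  using cell_unique down_closed by unfold_locales metis+

lemma card_col_transpositions: "card (transpositions n \<inter> col_group) = (\<Sum>x=1..n. row x)"
  using young_filling.card_row_transpositions[OF young_filling_conjugate]
  unfolding col_group_def young_filling.row_group_def[OF young_filling_conjugate] .

text \<open>The factorizations are \<open>\<tau> \<circ> id\<close> with sign 1 and
  \<open>id \<circ> \<tau>\<close> with sign -1; \<open>transposition_factors\<close> excludes
  others.\<close>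

lemma young_coeff_transposition:
  assumes \<tau>: "\<tau> \<in> transpositions n"
  shows "young_coeff \<tau> = of_bool (\<tau> \<in> row_group) - of_bool (\<tau> \<in> col_group)"
proof -
  have sign: "sign \<tau> = - 1" and "\<tau> \<noteq> id"
    using \<tau> by (auto simp: transpositions_def sign_swap_id transpose_eq_id_iff)
  consider "\<tau> \<in> row_group" | "\<tau> \<in> col_group" | "\<tau> \<notin> row_group" "\<tau> \<notin> col_group" by blast
  then show ?thesis
  proof cases
    case 1
    then have "factors \<tau> \<tau> id" "\<tau> \<notin> col_group"
      using col_group_id row_col_group_trivial \<open>\<tau> \<noteq> id\<close> by (auto simp: factors_def)
    then show ?thesis using 1 young_coeff_factors by simp
  next
    case 2
    then have "factors \<tau> id \<tau>" "\<tau> \<notin> row_group"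
      using row_group_id row_col_group_trivial \<open>\<tau> \<noteq> id\<close> by (auto simp: factors_def)
    then show ?thesis using 2 young_coeff_factors sign by simp
  next
    case 3
    then show ?thesis
      using transposition_factors[OF \<tau>] young_coeff_eq_0[of \<tau>] by auto
  qed
qed

section \<open>The symmetrizer as an eigenvector\<close>

lemma sum_young_coeff_transpositions:
  "(\<Sum>\<tau>\<in>transpositions n. young_coeff \<tau>) = real_of_int (\<Sum>x=1..n. int (col x) - int (row x))"
proof -
  have "(\<Sum>\<tau>\<in>transpositions n. young_coeff \<tau>)
      = (\<Sum>\<tau>\<in>transpositions n. of_bool (\<tau> \<in> row_group) - of_bool (\<tau> \<in> col_group))"
    by (rule sum.cong) (auto simp: young_coeff_transposition)
  also have "\<dots> = real (card (transpositions n \<inter> row_group))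
      - real (card (transpositions n \<inter> col_group))"
    by (simp add: sum_subtractf sum_of_bool_eq finite_transpositions)
  finally show ?thesis
    by (simp add: card_row_transpositions card_col_transpositions sum_subtractf)
qed

lemma young_coeff_eigen:
  assumes f: "f permutes {1..n}"
  shows "(\<Sum>\<tau>\<in>transpositions n. young_coeff (\<tau> \<circ> f))
    = real_of_int (\<Sum>x=1..n. int (col x) - int (row x)) * young_coeff f"
proof (cases "\<exists>p q. factors f p q")
  case True
  then obtain p q where pq: "factors f p q" by blast
  then have p: "p \<in> row_group" and q: "q \<in> col_group" and fpq: "f = p \<circ> q"
    by (auto simp: factors_def)
  note pp = row_group_permutes[OF p]
  have "(\<Sum>\<tau>\<in>transpositions n. young_coeff (\<tau> \<circ> f))
      = (\<Sum>\<tau>\<in>transpositions n. young_coeff (p \<circ> \<tau> \<circ> inv' p \<circ> f))"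
    by (rule sum.reindex_bij_betw[OF bij_betw_conj_transpositions[OF pp], symmetric])
  also have "\<dots> = (\<Sum>\<tau>\<in>transpositions n. young_coeff f * young_coeff \<tau>)"
  proof (rule sum.cong)
    fix \<tau>
    \<comment> \<open>Here \<open>p\<close> drops out on the left and \<open>q\<close> contributes
      its sign, which is \<open>young_coeff f\<close>, so the sum at \<open>f\<close> reduces to the
      sum at the identity.\<close>
    have "p \<circ> \<tau> \<circ> inv' p \<circ> f = p \<circ> (\<tau> \<circ> q)"
      using permutes_inverses(2)[OF pp] by (simp add: fpq fun_eq_iff)
    then show "young_coeff (p \<circ> \<tau> \<circ> inv' p \<circ> f) = young_coeff f * young_coeff \<tau>"
      using young_coeff_row[OF p] young_coeff_col[OF q] young_coeff_factors[OF pq] by simp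
  qed simp
  finally show ?thesis
    by (simp only: sum_distrib_left[symmetric] sum_young_coeff_transpositions)
      (rule mult.commute)
next
  case False
  then obtain a b where ab: "a \<in> {1..n}" "b \<in> {1..n}" "a \<noteq> b" "col a = col b" "row (f a) = row (f b)"
    using factors_exist[OF f] by blast
  define t where "t = Transposition.transpose (f a) (f b)"
  define t' where "t' = Transposition.transpose a b"
  have t: "t \<in> row_group"
    unfolding t_def using ab permutes_in_image[OF f] by (intro transpose_row_group) auto
  have t': "t' \<in> col_group" "sign t' = - 1"
    using ab transpose_col_group by (auto simp: t'_def sign_swap_id)
  have tf: "t \<circ> f = f \<circ> t'"
    using transpose_comp_eq[OF permutes_bij[OF f], of "f a" "f b"] permutes_inverses(2)[OF f]
    by (simp add: t_def t'_def)
  have "(\<Sum>\<tau>\<in>transpositions n. young_coeff (\<tau> \<circ> f))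
      = (\<Sum>\<tau>\<in>transpositions n. young_coeff (t \<circ> \<tau> \<circ> inv' t \<circ> f))"
    by (rule sum.reindex_bij_betw
        [OF bij_betw_conj_transpositions[OF row_group_permutes[OF t]], symmetric])
  also have "\<dots> = (\<Sum>\<tau>\<in>transpositions n. - young_coeff (\<tau> \<circ> f))"
  proof (rule sum.cong)
    fix \<tau>
    \<comment> \<open>As \<open>t\<close> is its own inverse, \<open>tf\<close> moves it past
      \<open>f\<close>. Then \<open>t\<close> drops out on the left and \<open>t'\<close> gives -1
      on the right, so the sum equals its own negative.\<close>
    have "t \<circ> \<tau> \<circ> inv' t \<circ> f = t \<circ> (\<tau> \<circ> f \<circ> t')"
      using tf by (simp add: t_def comp_assoc)
    then show "young_coeff (t \<circ> \<tau> \<circ> inv' t \<circ> f) = - young_coeff (\<tau> \<circ> f)"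
      using young_coeff_row[OF t] young_coeff_col[OF t'(1)] t'(2) by simp
  qed simp
  finally show ?thesis using young_coeff_eq_0[OF False] by (simp add: sum_negf)
qed

lemma eigenvalue_content:
  assumes "vertex_enumeration (transposition_graph n) vs"
  shows "eigenvalue (adjacency_matrix (transposition_graph n) vs)
    (real_of_int (\<Sum>x=1..n. int (col x) - int (row x)))"
proof (rule eigenvalue_transposition_graphI[OF assms permutes_id])
  have "factors id id id" by (simp add: factors_def row_group_id col_group_id)
  then show "young_coeff id \<noteq> 0" by (simp add: young_coeff_factors)
qed (rule young_coeff_eigen)

end

section \<open>Contents in Frobenius coordinates\<close>

text \<open>A list holds the pairs (arm, leg) of the principal hooks, outermost first. The parameters
  \<open>A\<close> and \<open>B\<close> are strict bounds for the arms and legs.\<close>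

fun frobenius :: "nat \<Rightarrow> nat \<Rightarrow> (nat \<times> nat) list \<Rightarrow> bool" where
  "frobenius A B [] \<longleftrightarrow> True"
| "frobenius A B ((a, b) # fs) \<longleftrightarrow> a < A \<and> b < B \<and> frobenius a b fs"

fun frob_size :: "(nat \<times> nat) list \<Rightarrow> nat" where
  "frob_size [] = 0"
| "frob_size ((a, b) # fs) = Suc (a + b + frob_size fs)"

text \<open>An arm has contents 1 to \<open>a\<close> and a leg -1 to \<open>-b\<close>. Every hook
  has its corner on the main diagonal, so nesting changes no content.\<close>

fun frob_content :: "(nat \<times> nat) list \<Rightarrow> int" where
  "frob_content [] = 0"
| "frob_content ((a, b) # fs) = int (a * Suc a div 2) - int (b * Suc b div 2) + frob_content fs"

text \<open>The corner is counted with the arm, hence \<open>{..a}\<close> against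
  \<open>{..<b}\<close>; the inner hooks are shifted one step along the diagonal.\<close>

fun frob_diagram :: "(nat \<times> nat) list \<Rightarrow> (nat \<times> nat) set" where
  "frob_diagram [] = {}"
| "frob_diagram ((a, b) # fs) =
    Pair 0 ` {..a} \<union> (\<lambda>i. (Suc i, 0)) ` {..<b} \<union> map_prod Suc Suc ` frob_diagram fs"

lemma frob_diagram_bounded:
  "frobenius A B fs \<Longrightarrow> (i, j) \<in> frob_diagram fs \<Longrightarrow> i < B \<and> j < A"
  by (induction A B fs arbitrary: i j rule: frobenius.induct) fastforce+

lemma finite_frob_diagram: "finite (frob_diagram fs)"
  by (induction fs rule: frob_diagram.induct) auto

text \<open>The strict bounds keep the shifted inner diagram below the arm and beside the leg, so
  lowering a coordinate to 0 lands in the outer hook.\<close>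

lemma frob_diagram_down_closed:
  "frobenius A B fs \<Longrightarrow> (i, j) \<in> frob_diagram fs \<Longrightarrow> i' \<le> i \<Longrightarrow> j' \<le> j
    \<Longrightarrow> (i', j') \<in> frob_diagram fs"
proof (induction A B fs arbitrary: i j i' j' rule: frobenius.induct)
  case (2 A B a b fs)
  have bd: "k < b \<and> l < a" if "(k, l) \<in> frob_diagram fs" for k l
    using frob_diagram_bounded[of a b fs k l] 2(2) that by simp
  show ?case
  proof (cases i')
    case 0
    have "j \<le> a" using 2(3) bd by fastforce
    then show ?thesis using 0 2(5) by auto
  next
    case (Suc i'')
    show ?thesis
    proof (cases j')
      case 0
      have "i \<le> b" using 2(3) bd by fastforce
      then show ?thesis using 0 Suc 2(4) by auto
    next
      case (Suc j'')
      then obtain k l where "(k, l) \<in> frob_diagram fs" "i = Suc k" "j = Suc l"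
        using 2(3,4,5) \<open>i' = Suc i''\<close> by auto
      then have "(i'', j'') \<in> frob_diagram fs"
        using 2 Suc \<open>i' = Suc i''\<close> by auto
      then show ?thesis using Suc \<open>i' = Suc i''\<close> by force
    qed
  qed
qed simp

lemma sum_frob_diagram_Cons:
  fixes g :: "nat \<times> nat \<Rightarrow> int"
  shows "sum g (frob_diagram ((a, b) # fs)) =
    (\<Sum>j\<le>a. g (0, j)) + (\<Sum>i<b. g (Suc i, 0)) + (\<Sum>(i, j)\<in>frob_diagram fs. g (Suc i, Suc j))"
proof -
  have "sum g (frob_diagram ((a, b) # fs)) =
      sum g (Pair 0 ` {..a}) + sum g ((\<lambda>i. (Suc i, 0)) ` {..<b})
      + sum g (map_prod Suc Suc ` frob_diagram fs)"
  proof -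
    have "Pair 0 ` {..a} \<inter> (\<lambda>i. (Suc i, 0 :: nat)) ` {..<b} = {}" by auto
    moreover have "(Pair 0 ` {..a} \<union> (\<lambda>i. (Suc i, 0)) ` {..<b})
        \<inter> map_prod Suc Suc ` frob_diagram fs = {}" by auto
    ultimately show ?thesis
      by (simp add: sum.union_disjoint finite_frob_diagram)
  qed
  also have "sum g (Pair 0 ` {..a}) = (\<Sum>j\<le>a. g (0, j))"
    by (subst sum.reindex) (auto simp: inj_on_def)
  also have "sum g ((\<lambda>i. (Suc i, 0)) ` {..<b}) = (\<Sum>i<b. g (Suc i, 0))"
    by (subst sum.reindex) (auto simp: inj_on_def)
  also have "sum g (map_prod Suc Suc ` frob_diagram fs)
      = (\<Sum>(i, j)\<in>frob_diagram fs. g (Suc i, Suc j))"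
    by (subst sum.reindex) (auto simp: inj_on_def case_prod_unfold map_prod_def)
  finally show ?thesis .
qed

lemma card_frob_diagram: "card (frob_diagram fs) = frob_size fs"
proof -
  have "(\<Sum>x\<in>frob_diagram fs. 1 :: int) = int (frob_size fs)"
    by (induction fs rule: frob_size.induct)
      (simp, simp only: sum_frob_diagram_Cons, simp)
  then show ?thesis by simp
qed

lemma sum_content_frob_diagram:
  "(\<Sum>(i, j)\<in>frob_diagram fs. int j - int i) = frob_content fs"
proof (induction fs rule: frob_content.induct)
  case (2 a b fs)
  have "(\<Sum>j\<le>a. int j) = int (a * Suc a div 2)"
    by (induction a) auto
  moreover have "(\<Sum>i<b. - 1 - int i) = - int (b * Suc b div 2)"
    by (induction b) auto
  ultimately show ?case
    using 2 by (simp add: sum_frob_diagram_Cons del: frob_diagram.simps)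
qed simp

section \<open>Realising intervals of contents\<close>

text \<open>The bound \<open>A\<close> is recorded because the partitions fit inside any hook whose
  arm and leg are at least \<open>A\<close>. Using it for both arms and legs keeps the notion
  invariant under conjugation.\<close>

definition covers :: "nat \<Rightarrow> nat \<Rightarrow> nat \<Rightarrow> bool" where
  "covers n A L \<longleftrightarrow>
    (\<forall>k. \<bar>k\<bar> \<le> int L \<longrightarrow> (\<exists>fs. frobenius A A fs \<and> frob_size fs = n \<and> frob_content fs = k))"

lemma frob_conjugate:
  "frobenius A B fs \<Longrightarrow> frobenius B A (map prod.swap fs)"
  "frob_size (map prod.swap fs) = frob_size fs"
  "frob_content (map prod.swap fs) = - frob_content fs"
  by (induction A B fs rule: frobenius.induct) auto

text \<open>Conjugation negates contents, so nonnegative values suffice.\<close>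

lemma coversI:
  assumes "\<And>k. k \<le> L \<Longrightarrow> \<exists>fs. frobenius A A fs \<and> frob_size fs = n \<and> frob_content fs = int k"
  shows "covers n A L"
  unfolding covers_def
proof (intro allI impI)
  fix k :: int
  assume k: "\<bar>k\<bar> \<le> int L"
  then obtain fs where fs: "frobenius A A fs" "frob_size fs = n" "frob_content fs = \<bar>k\<bar>"
    using assms[of "nat \<bar>k\<bar>"] by (metis abs_ge_zero nat_0_le nat_le_iff)
  show "\<exists>fs. frobenius A A fs \<and> frob_size fs = n \<and> frob_content fs = k"
  proof (cases "k \<ge> 0")
    case False
    then show ?thesis
      using fs frob_conjugate(1)[of A A fs] frob_conjugate(2,3)[of fs]
      by (intro exI[of _ "map prod.swap fs"]) auto
  qed (use fs in auto)
qed

lemma coversD: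
  assumes "covers n A L" "\<bar>k\<bar> \<le> int L"
  obtains fs where "frobenius A A fs" "frob_size fs = n" "frob_content fs = k"
  using assms unfolding covers_def by blast

lemma frobenius_mono: "frobenius A B fs \<Longrightarrow> A \<le> A' \<Longrightarrow> B \<le> B' \<Longrightarrow> frobenius A' B' fs"
  by (cases fs) auto

lemma covers_mono: "covers n A L \<Longrightarrow> A \<le> A' \<Longrightarrow> L' \<le> L \<Longrightarrow> covers n A' L'"
  unfolding covers_def by (meson frobenius_mono of_nat_mono order_trans)

text \<open>Consecutive terms differ by at most \<open>2 * L + 1\<close>, so the radius
  \<open>L\<close> intervals around them leave no integer out; the first reaches 0 because
  \<open>e \<le> L\<close>.\<close>

lemma nearby_progression_term:
  fixes k e :: nat
  assumes "s \<le> 2 * L" "e \<le> L" "k \<le> e + t * Suc s + L"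
  shows "\<exists>t'\<le>t. \<bar>int k - int (e + t' * Suc s)\<bar> \<le> int L"
  using assms(3)
proof (induction t)
  case 0
  then show ?case using assms by auto
next
  case (Suc t)
  show ?case
  proof (cases "k \<le> e + t * Suc s + L")
    case True
    then show ?thesis using Suc.IH le_SucI by blast
  next
    case False
    have "int (e + Suc t * Suc s) = int (e + t * Suc s) + int s + 1" by simp
    then have "\<bar>int k - int (e + Suc t * Suc s)\<bar> \<le> int L"
      using Suc.prems assms(1) False by linarith
    then show ?thesis by blast
  qed
qed

text \<open>An outer hook with arm \<open>b + d\<close> and leg \<open>b\<close>, where \<open>s = 2 * b + d\<close>, contributes the content
  \<open>d * (s + 1) / 2\<close>. Letting \<open>d\<close> vary in its parity class gives an arithmetic progression of
  difference \<open>s + 1\<close>, and an inner partition fills the gaps.\<close>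

lemma covers_hook:
  assumes cov: "covers n A L" and s: "s \<le> 2 * L" and d: "2 * A + d \<le> s" "even (s + d)"
    and L': "2 * L' \<le> d * Suc s + 2 * L"
    and A': "s + d < 2 * A'" and n': "n' = Suc (n + s)"
  shows "covers n' A' L'"
proof (rule coversI)
  fix k assume k: "k \<le> L'"
  \<comment> \<open>The smallest difference in the parity class is \<open>r\<close>, its hook
    content is \<open>e\<close>, and \<open>t\<close> steps lead from \<open>r\<close> to
    \<open>d\<close>.\<close>
  define r where "r = d mod 2"
  define e where "e = r * Suc s div 2"
  define t where "t = d div 2"
  have r: "r \<le> 1" and dr: "d = r + 2 * t" by (auto simp: r_def t_def)
  have e2: "2 * e = r * Suc s"
  proof (cases "even d")
    case True
    then show ?thesis by (simp add: e_def r_def)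
  next
    case False
    then have "odd s" using d by auto
    then show ?thesis using False by (simp add: e_def r_def odd_iff_mod_2_eq_one)
  qed
  have "e \<le> L"
  proof (cases "r = 0")
    case True
    then show ?thesis by (simp add: e_def)
  next
    case False
    then have "r = 1" using r by simp
    then show ?thesis using e2 s by simp
  qed
  moreover have "d * Suc s = 2 * (e + t * Suc s)"
    using e2 by (simp add: dr algebra_simps)
  then have "2 * L' \<le> 2 * (e + t * Suc s + L)" using L' by simp
  then have "k \<le> e + t * Suc s + L" using k by (meson le_trans nat_mult_le_cancel1 zero_less_numeral)
  ultimately obtain t' where t': "t' \<le> t" "\<bar>int k - int (e + t' * Suc s)\<bar> \<le> int L"
    using nearby_progression_term s by blast
  then obtain fs where fs: "frobenius A A fs" "frob_size fs = n"
      "frob_content fs = int k - int (e + t' * Suc s)"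
    using coversD[OF cov] by metis
  define d' where "d' = r + 2 * t'"
  define b where "b = (s - d') div 2"
  have "d' \<le> d" "even (s + d')" using t' dr d by (auto simp: d'_def)
  then have sb: "s = 2 * b + d'" using d by (auto simp: b_def)
  \<comment> \<open>Doubled, this is \<open>(b + d') * (b + d' + 1) - b * (b + 1) = d' * (2 * b + d'
    + 1)\<close>.\<close>
  have hook: "int ((b + d') * Suc (b + d') div 2) - int (b * Suc b div 2) = int (e + t' * Suc s)"
  proof -
    have 1: "2 * (x * Suc x div 2) = x * Suc x" for x :: nat by simp
    have "2 * (e + t' * Suc s) = d' * Suc s" using e2 by (simp add: d'_def algebra_simps)
    then have "2 * ((b + d') * Suc (b + d') div 2) = 2 * (b * Suc b div 2) + 2 * (e + t' * Suc s)"
      unfolding 1 by (simp add: sb algebra_simps)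
    moreover have "2 * x = 2 * y + 2 * z \<Longrightarrow> int x - int y = int z" for x y z :: nat by linarith
    ultimately show ?thesis by blast
  qed
  show "\<exists>fs. frobenius A' A' fs \<and> frob_size fs = n' \<and> frob_content fs = int k"
  proof (intro exI conjI)
    \<comment> \<open>From \<open>2 * A + d \<le> s\<close> the leg \<open>b\<close> is at least
      \<open>A\<close>; the arm is \<open>(s + d') / 2\<close>, below \<open>A'\<close>.\<close>
    show "frobenius A' A' ((b + d', b) # fs)"
      using frobenius_mono[OF fs(1), of "b + d'" b] sb d A' \<open>d' \<le> d\<close> by simp
    show "frob_size ((b + d', b) # fs) = n'" using fs n' sb by simp
    show "frob_content ((b + d', b) # fs) = int k" using fs hook by simp
  qed
qed

section \<open>Base cases and the induction on \<open>n\<close>\<close>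

lemma coversI_list:
  assumes "\<forall>fs\<in>set cs. frobenius A A fs \<and> frob_size fs = n"
    and "map frob_content cs = map int [0..<Suc L]"
  shows "covers n A L"
proof (rule coversI)
  fix k assume "k \<le> L"
  moreover have "length cs = Suc L" using arg_cong[OF assms(2), of length] by simp
  ultimately have "cs ! k \<in> set cs" "frob_content (cs ! k) = int k"
    using arg_cong[OF assms(2), of "\<lambda>xs. xs ! k"] by (auto simp del: upt_Suc)
  then show "\<exists>fs. frobenius A A fs \<and> frob_size fs = n \<and> frob_content fs = int k"
    using assms(1) by blast
qed

text \<open>The listed partitions have content sums 0, 1, ..., 12 in this order. Reach 12 admits
  hooks with \<open>s \<le> 24\<close>.\<close>

lemma covers_13: "covers 13 6 12"
  by (rule coversI_list[of "[[(3,3),(2,2),(0,0)], [(5,5),(1,0)], [(4,3),(1,2),(0,0)],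
      [(3,3),(2,1),(1,0)], [(4,3),(2,2)], [(5,4),(1,1)], [(4,3),(2,1),(0,0)], [(5,3),(1,2)],
      [(5,4),(2,0)], [(4,3),(3,1)], [(4,2),(2,1),(1,0)], [(5,3),(2,1)], [(4,2),(3,1),(0,0)]]"])
    (simp_all add: upt_rec)

lemma covers_17: "covers 17 8 22"
  by (rule coversI_list[of "[[(4,4),(2,2),(1,1)], [(4,5),(3,1),(1,0)], [(4,4),(3,2),(0,1)],
      [(5,5),(2,1),(1,0)], [(4,3),(2,2),(1,1),(0,0)], [(5,4),(3,3)], [(5,4),(2,2),(1,0)],
      [(4,3),(3,2),(1,1)], [(4,4),(3,1),(2,0)], [(5,3),(2,2),(1,1)], [(4,3),(3,2),(2,0)],
      [(5,3),(3,2),(0,1)], [(5,4),(4,2)], [(5,3),(3,2),(1,0)], [(5,4),(4,1),(0,0)],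
      [(7,5),(2,1)], [(5,3),(4,2),(0,0)], [(5,3),(3,1),(2,0)], [(6,3),(3,2),(0,0)],
      [(5,3),(4,1),(1,0)], [(6,4),(4,1)], [(6,3),(3,1),(1,0)], [(6,3),(4,2)]]"])
    (simp_all add: upt_rec)

text \<open>The conjunct \<open>n - 1 \<le> L\<close> drives the induction: it gives
  \<open>s \<le> 2 * L\<close> for a hook about twice as large as the inner partition, so
  \<open>n\<close> is reached from about \<open>n / 3\<close>.\<close>

lemma covers_from_28:
  assumes "n \<ge> 28"
  shows "\<exists>L. covers n (n div 2) L \<and> n - 1 \<le> L \<and> ((n - 15) div 3) choose 2 \<le> L"
  using assms
proof (induction n rule: less_induct)
  case (less n)
  define m where "m = (n - 15) div 3"
  have choose: "2 * (m choose 2) = m * (m - 1)"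
    by (cases m) (simp_all add: choose_two)
  have "\<exists>L. covers n (n div 2) L \<and> n - 1 \<le> L \<and> m choose 2 \<le> L"
  proof -
    \<comment> \<open>The condition \<open>s \<le> 2 * L\<close> lets the inner size 13 serve up to
      38 and the inner size 28, with \<open>L \<ge> 27\<close>, up to 83; size 17 bridges the
      gap.\<close>
    consider "n \<le> 38" | "39 \<le> n" "n \<le> 61" | "62 \<le> n" "n \<le> 83" | "84 \<le> n"
      using less.prems by linarith
    then show ?thesis
    proof cases
      case 1
      define s where "s = n - 14"
      \<comment> \<open>The parity of \<open>s\<close> is matched, and \<open>d \<ge> 2\<close>
        gives reach \<open>s + 1 + 12\<close>, exactly \<open>n - 1\<close>.\<close>
      define d where "d = 2 + s mod 2"
      have s: "n = s + 14" "14 \<le> s" "s \<le> 24" using less.prems 1 by (auto simp: s_def)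
      have "covers n (n div 2) (n - 1)"
      proof (rule covers_hook[OF covers_13])
        show "2 * 6 + d \<le> s" using s unfolding d_def by presburger
        show "even (s + d)" by (simp add: d_def)
        have "2 * Suc s \<le> d * Suc s" by (rule mult_right_mono) (simp_all add: d_def)
        then show "2 * (n - 1) \<le> d * Suc s + 2 * 12" using s by simp
        show "s + d < 2 * (n div 2)" using s unfolding d_def by presburger
      qed (use s in auto)
      moreover have "m \<le> 7" using 1 unfolding m_def by presburger
      then have "m * (m - 1) \<le> 7 * 6" by (intro mult_mono) auto
      then have "m choose 2 \<le> n - 1" if "n > 21" using choose that by linarith
      ultimately show ?thesis using less.prems by auto
    next
      case 2
      define s where "s = n - 18"
      \<comment> \<open>The room condition \<open>2 * 8 + d \<le> s\<close> is tight at
        \<open>n = 39\<close>.\<close>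
      define d where "d = 4 + s mod 2"
      define L where "L = 2 * Suc s + 22"
      have s: "n = s + 18" "21 \<le> s" "s \<le> 43" using 2 by (auto simp: s_def)
      have "covers n (n div 2) L"
      proof (rule covers_hook[OF covers_17])
        show "2 * 8 + d \<le> s" using s unfolding d_def by presburger
        show "even (s + d)" by (simp add: d_def)
        have "4 * Suc s \<le> d * Suc s" by (rule mult_right_mono) (simp_all add: d_def)
        then show "2 * L \<le> d * Suc s + 2 * 22" by (simp add: L_def)
        show "s + d < 2 * (n div 2)" using s unfolding d_def by presburger
      qed (use s in auto)
      moreover have "m choose 2 \<le> L"
      proof -
        have m: "3 * m \<le> s + 3" using s unfolding m_def by presburger
        have "m * (m - 1) \<le> 15 * (m - 1)" using m s by (intro mult_right_mono) auto
        also have "\<dots> \<le> 2 * L" using m s by (simp add: L_def)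
        finally show ?thesis using choose by simp
      qed
      ultimately show ?thesis by (intro exI[of _ L]) (auto simp: L_def s)
    next
      case 3
      obtain L where L: "covers 28 14 L" "27 \<le> L" using less.IH[of 28] 3 by auto
      \<comment> \<open>The hook has \<open>s = t + 28\<close>, and \<open>d = t\<close> is the
        largest difference leaving room for the inner bound 14.\<close>
      define t where "t = n - 57"
      have t: "n = t + 57" "5 \<le> t" "t \<le> 26" using 3 by (auto simp: t_def)
      define L' where "L' = t * (t + 29) div 2 + 27"
      have "even (t * (t + 29))" by simp
      then have L': "2 * L' = t * (t + 29) + 54" by (simp add: L'_def)
      have "covers n (n div 2) L'"
      proof (rule covers_hook[OF L(1)])
        show "t + 28 \<le> 2 * L" using t L by simp
        show "2 * L' \<le> t * Suc (t + 28) + 2 * L" using L' L by (simp add: add.commute)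
        show "t + 28 + t < 2 * (n div 2)" using t by presburger
      qed (use t in auto)
      moreover have "5 * (t + 29) \<le> t * (t + 29)" using t by (intro mult_right_mono) auto
      then have "n - 1 \<le> L'" using L' t by simp
      moreover have "m choose 2 \<le> L'"
      \<comment> \<open>At \<open>t = 5\<close> the estimate through
        \<open>3 * m \<le> t + 42\<close> is too weak, so the values 105 and 112 are compared
        directly.\<close>
      proof (cases "t = 5")
        case True
        then show ?thesis using t by (simp add: m_def L'_def choose_two)
      next
        case False
        have m: "3 * m \<le> t + 42" using t unfolding m_def by presburger
        have "9 * (m * (m - 1)) = (3 * m) * (3 * m - 3)" by (simp add: algebra_simps)
        also have "\<dots> \<le> (t + 42) * (t + 39)" using m by (intro mult_mono) auto
        also have "\<dots> = t * t + 81 * t + 1638" by (simp add: algebra_simps)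
        also have "\<dots> \<le> 9 * (2 * L')"
        proof -
          have "6 \<le> t" using t False by simp
          moreover from this have "6 * t \<le> t * t" by (rule mult_right_mono) simp
          moreover have "2 * L' = t * t + 29 * t + 54" using L' by (simp add: algebra_simps)
          ultimately show ?thesis by linarith
        qed
        finally show ?thesis using choose by simp
      qed
      ultimately show ?thesis by blast
    next
      case 4
      \<comment> \<open>The least \<open>n'\<close> with \<open>n + 1 \<le> 3 * n'\<close>, so that
        \<open>s = n - n' - 1\<close> is at most \<open>2 * (n' - 1)\<close>.\<close>
      define n' where "n' = (n + 3) div 3"
      have n': "n + 1 \<le> 3 * n'" "3 * n' \<le> n + 3" "29 \<le> n'" "n' < n"
        using 4 by (auto simp: n'_def)
      obtain L where L: "covers n' (n' div 2) L" "n' - 1 \<le> L" using less.IH[of n'] n' by auto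
      define s where "s = n - n' - 1"
      have s: "n = s + n' + 1" using n' by (simp add: s_def)
      \<comment> \<open>The last summand matches the parity of \<open>s\<close>. Since
        \<open>s \<ge> 2 * n' - 4\<close>, a difference up to \<open>n' - 4\<close> leaves room for
        the inner partition.\<close>
      define d where "d = n' - 5 + (s + n' + 1) mod 2"
      have d: "n' - 5 \<le> d" "d \<le> n' - 4" "even (s + d)"
        using n'(3) unfolding d_def by presburger+
      define X where "X = (n' - 5) * (2 * n' - 3)"
      define L' where "L' = X div 2"
      have X: "X \<le> d * Suc s" unfolding X_def using d n' s by (intro mult_mono) auto
      have big: "24 * (2 * n' - 3) \<le> X" unfolding X_def using n' by (intro mult_right_mono) auto
      have "covers n (n div 2) L'"
      proof (rule covers_hook[OF L(1)])
        show "s \<le> 2 * L" using n' L s by linarith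
        show "2 * (n' div 2) + d \<le> s" using n' d s by linarith
        show "even (s + d)" by (rule d)
        have "2 * L' \<le> X" by (simp add: L'_def)
        then show "2 * L' \<le> d * Suc s + 2 * L" using X by linarith
        show "s + d < 2 * (n div 2)" using n' d s by linarith
      qed (use s in auto)
      moreover have "n - 1 \<le> L'" using big n' unfolding L'_def by linarith
      moreover have "m choose 2 \<le> L'"
      proof -
        have m: "m \<le> n' - 5" using n' unfolding m_def by presburger
        have "2 * (m choose 2) \<le> X"
          unfolding choose X_def using m n' by (intro mult_mono) auto
        then show ?thesis by (simp add: L'_def)
      qed
      ultimately show ?thesis by blast
    qed
  qed
  then show ?case by (simp only: m_def)
qed

lemma covers_choose_two:
  assumes "n \<ge> 27"
  shows "\<exists>A. covers n A (((n - 15) div 3) choose 2)"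
proof (cases "n = 27")
  case True
  \<comment> \<open>Here \<open>s = 13\<close> forces \<open>d = 1\<close>. The resulting reach 19
    is below \<open>n - 1\<close>, so this case stays outside the induction, but only 6 is
    required.\<close>
  have "covers n 8 6"
    by (rule covers_hook[OF covers_13, of 13 1]) (use True in auto)
  then show ?thesis using True by (auto simp: choose_two)
next
  case False
  then have "n \<ge> 28" using assms by simp
  then show ?thesis using covers_from_28 covers_mono[OF _ order_refl] by blast
qed

section \<open>From partitions to eigenvalues\<close>

lemma eigenvalue_frob_content:
  assumes fs: "frobenius A B fs" "frob_size fs = n"
    and vs: "vertex_enumeration (transposition_graph n) vs"
  shows "eigenvalue (adjacency_matrix (transposition_graph n) vs) (real_of_int (frob_content fs))"
proof -
  let ?D = "frob_diagram fs"
  \<comment> \<open>Any numbering of the cells serves, as the content sum depends on the diagram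
    alone.\<close>
  obtain h where "bij_betw h {1..card ?D} ?D"
    using ex_bij_betw_nat_finite_1[OF finite_frob_diagram] by blast
  then have h: "bij_betw h {1..n} ?D" using fs by (simp add: card_frob_diagram)
  interpret young_filling n "\<lambda>x. fst (h x)" "\<lambda>x. snd (h x)"
  proof
    fix x y assume "x \<in> {1..n}" "y \<in> {1..n}" "fst (h x) = fst (h y)" "snd (h x) = snd (h y)"
    then show "x = y" using bij_betw_imp_inj_on[OF h] by (meson inj_onD prod_eqI)
  next
    fix x i j assume x: "x \<in> {1..n}" "i \<le> fst (h x)" "j \<le> snd (h x)"
    then have "(fst (h x), snd (h x)) \<in> ?D" using bij_betwE[OF h] by simp
    then have "(i, j) \<in> ?D" using frob_diagram_down_closed fs(1) x by blast
    then have "(i, j) \<in> h ` {1..n}" by (simp only: bij_betw_imp_surj_on[OF h])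
    then obtain y where "y \<in> {1..n}" "(i, j) = h y" by (rule imageE)
    then show "\<exists>y\<in>{1..n}. fst (h y) = i \<and> snd (h y) = j" by (metis fst_conv snd_conv)
  qed
  have "(\<Sum>x=1..n. int (snd (h x)) - int (fst (h x))) = (\<Sum>(i, j)\<in>?D. int j - int i)"
    using sum.reindex_bij_betw[OF h, of "\<lambda>(i, j). int j - int i"] by (simp add: case_prod_unfold)
  then show ?thesis using eigenvalue_content[OF vs] by (simp add: sum_content_frob_diagram)
qed

theorem theorem1p4:
  fixes n :: nat and k :: int and vs :: "(nat \<Rightarrow> nat) list"
  assumes "n \<ge> 27"
    and "k \<in> {- int (((n - 15) div 3) choose 2) .. int (((n - 15) div 3) choose 2)}"
    and "vertex_enumeration (transposition_graph n) vs"
  shows "eigenvalue (adjacency_matrix (transposition_graph n) vs) (real_of_int k)"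
proof -
  obtain A where "covers n A (((n - 15) div 3) choose 2)"
    using covers_choose_two[OF assms(1)] by blast
  moreover have "\<bar>k\<bar> \<le> int (((n - 15) div 3) choose 2)" using assms(2) by auto
  ultimately obtain fs where "frobenius A A fs" "frob_size fs = n" "frob_content fs = k"
    by (rule coversD)
  then show ?thesis using eigenvalue_frob_content assms(3) by blast
qed

end
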